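(* Let $X$ be a connected graph and let the Hamiltonian $M$ be one of $A$, $L$, $Q$. Let $a\neq b$ be vertices of $X$, let $s\in\mathbb{C}\setminus\{0\}$, and let $\mathbf u=\mathbf e_a+s\mathbf e_b$. If $\mathbf u$ is a fixed state (an eigenvector of $M$), then $|\Phi_{\mathbf u}|=1$. Otherwise $$|\Phi_{\mathbf u}|\ \ge\ \left\lceil \frac{\operatorname{dist}(a,b)}{2}\right\rceil ,$$ where $\operatorname{dist}(a,b)$ is the graph distance between $a$ and $b$.
   Context: Graphs are simple, undirected, unweighted and connected. $A$ is the adjacency matrix, $L=D-A$ the Laplacian and $Q=D+A$ the signless Laplacian, where $D$ is the diagonal degree matrix. For a real symmetric matrix $M$ with spectral decomposition $M=\sum_{\lambda\in\operatorname{spec}(M)}\lambda E_\lambda$ ($E_\lambda$ the orthogonal projection onto the $\lambda$-eigenspace), the eigenvalue support of a vector $\mathbf v$ is $\Phi_{\mathbf v}=\{\lambda: E_\lambda\mathbf v\neq \mathbf 0\}$. $\mathbf e_v$ denotes the standard basis vector of vertex $v$. *)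

theory Defs
  imports "HOL-Analysis.Analysis"
begin

text \<open>Graphs on a finite vertex type 'n, given by an edge predicate E.\<close>

definition simple_graph :: "('n \<Rightarrow> 'n \<Rightarrow> bool) \<Rightarrow> bool" where
  "simple_graph E \<longleftrightarrow> (\<forall>x y. E x y \<longrightarrow> E y x) \<and> (\<forall>x. \<not> E x x)"

definition edge_rel :: "('n \<Rightarrow> 'n \<Rightarrow> bool) \<Rightarrow> ('n \<times> 'n) set" where
  "edge_rel E = {(x, y). E x y}"

definition connected_graph :: "('n \<Rightarrow> 'n \<Rightarrow> bool) \<Rightarrow> bool" where
  "connected_graph E \<longleftrightarrow> (\<forall>x y. (x, y) \<in> (edge_rel E)\<^sup>*)"

text \<open>Graph distance: length of a shortest walk.\<close>
definition graph_dist :: "('n \<Rightarrow> 'n \<Rightarrow> bool) \<Rightarrow> 'n \<Rightarrow> 'n \<Rightarrow> nat" where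
  "graph_dist E a b = (LEAST k. (a, b) \<in> (edge_rel E) ^^ k)"

definition vdegree :: "('n::finite \<Rightarrow> 'n \<Rightarrow> bool) \<Rightarrow> 'n \<Rightarrow> nat" where
  "vdegree E v = card {w. E v w}"

definition adj_matrix :: "('n::finite \<Rightarrow> 'n \<Rightarrow> bool) \<Rightarrow> complex^'n^'n" where
  "adj_matrix E = (\<chi> i j. if E i j then 1 else 0)"

definition deg_matrix :: "('n::finite \<Rightarrow> 'n \<Rightarrow> bool) \<Rightarrow> complex^'n^'n" where
  "deg_matrix E = (\<chi> i j. if i = j then of_nat (vdegree E i) else 0)"

definition laplacian :: "('n::finite \<Rightarrow> 'n \<Rightarrow> bool) \<Rightarrow> complex^'n^'n" where
  "laplacian E = deg_matrix E - adj_matrix E"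

definition signless_laplacian :: "('n::finite \<Rightarrow> 'n \<Rightarrow> bool) \<Rightarrow> complex^'n^'n" where
  "signless_laplacian E = deg_matrix E + adj_matrix E"

text \<open>Standard Hermitian inner product on complex^'n.\<close>
definition cinner :: "complex^'n::finite \<Rightarrow> complex^'n \<Rightarrow> complex" where
  "cinner x y = (\<Sum>i\<in>UNIV. cnj (x $ i) * y $ i)"

definition eig_space :: "complex^'n^'n::finite \<Rightarrow> complex \<Rightarrow> (complex^'n) set" where
  "eig_space M \<mu> = {v. M *v v = \<mu> *s v}"

definition mat_spec :: "complex^'n^'n::finite \<Rightarrow> complex set" where
  "mat_spec M = {\<mu>. \<exists>v. v \<noteq> 0 \<and> M *v v = \<mu> *s v}"

text \<open>E_lambda u: the orthogonal projection of u onto the lambda-eig_space.\<close>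
definition eig_proj :: "complex^'n^'n::finite \<Rightarrow> complex \<Rightarrow> complex^'n \<Rightarrow> complex^'n" where
  "eig_proj M \<mu> u = (THE w. w \<in> eig_space M \<mu> \<and>
      (\<forall>v \<in> eig_space M \<mu>. cinner v (u - w) = 0))"

definition eig_support :: "complex^'n^'n::finite \<Rightarrow> complex^'n \<Rightarrow> complex set" where
  "eig_support M u = {\<mu> \<in> mat_spec M. eig_proj M \<mu> u \<noteq> 0}"

definition is_eigenvector :: "complex^'n^'n::finite \<Rightarrow> complex^'n \<Rightarrow> bool" where
  "is_eigenvector M u \<longleftrightarrow> u \<noteq> 0 \<and> (\<exists>\<mu>. M *v u = \<mu> *s u)"

end

theory Submission
  imports Defs "HOL-Computational_Algebra.Fundamental_Theorem_Algebra"
begin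

(*
  Let k = |\<Phi>_u| and p(x) = \<Prod>_{\<lambda>\<in>\<Phi>_u} (x - \<lambda>). Since M is Hermitian, p(M)u = 0: otherwise
  the Krylov space of p(M)u contains an eigenvector w, say with eigenvalue r, and
  \<langle>w,w\<rangle> = (hp)(r)\<langle>w,u\<rangle> = 0 because either r \<in> \<Phi>_u or u is orthogonal to the r-eigenspace.
  Off the diagonal M equals \<sigma>A with \<sigma> = \<plusminus>1, so (M^j e_a)_y vanishes when dist(a,y) > j and is
  \<sigma>^j times a positive number when dist(a,y) = j. If dist(a,b) > 2k, evaluate p(M)u = 0 at
  the vertex at distance k from a on a shortest a-b path: only the leading term M^k e_a
  contributes there, a contradiction. If u is an eigenvector, orthogonality of the
  eigenspaces gives \<Phi>_u = {its eigenvalue}.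
*)

section \<open>The Hermitian inner product\<close>

lemma scaleR_eq_of_real_scale: "c *\<^sub>R (x::complex^'n) = complex_of_real c *s x"
  by (simp add: vec_eq_iff scaleR_conv_of_real[where 'a=complex])

lemma cinner_add_right: "cinner x (y + z) = cinner x y + cinner x z"
  by (simp add: cinner_def distrib_left sum.distrib)

lemma cinner_diff_right: "cinner x (y - z) = cinner x y - cinner x z"
  by (simp add: cinner_def right_diff_distrib sum_subtractf)

lemma cinner_scale_right: "cinner x (c *s y) = c * cinner x y"
  by (simp add: cinner_def sum_distrib_left algebra_simps)

lemma cinner_scale_left: "cinner (c *s x) y = cnj c * cinner x y"
  by (simp add: cinner_def sum_distrib_left algebra_simps)

lemma Re_cinner: "Re (cinner x y) = x \<bullet> y"
  by (simp add: cinner_def inner_vec_def inner_complex_def)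

lemma Im_cinner: "Im (cinner x y) = (\<i> *s x) \<bullet> y"
  by (simp add: cinner_def inner_vec_def inner_complex_def algebra_simps)

lemma cinner_self_eq_0 [simp]: "cinner x x = 0 \<longleftrightarrow> x = 0"
proof
  assume "cinner x x = 0"
  then have "x \<bullet> x = 0" using Re_cinner[of x x] by simp
  then show "x = 0" by simp
qed (simp add: cinner_def)

section \<open>Polynomials in a matrix acting on a vector\<close>

definition poly_mv :: "complex^'n::finite^'n \<Rightarrow> complex poly \<Rightarrow> complex^'n \<Rightarrow> complex^'n" where
  "poly_mv M q v = (\<Sum>i\<le>degree q. coeff q i *s ((*v) M ^^ i) v)"

lemma mpow_vec_add:
  fixes M :: "complex^'n::finite^'n"
  shows "((*v) M ^^ i) (x + y) = ((*v) M ^^ i) x + ((*v) M ^^ i) y"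
  by (induction i) (simp_all add: matrix_vector_right_distrib)

lemma mpow_vec_scale:
  fixes M :: "complex^'n::finite^'n"
  shows "((*v) M ^^ i) (c *s x) = c *s ((*v) M ^^ i) x"
  by (induction i) (simp_all add: vector_scalar_commute)

lemma poly_mv_eq_sum:
  assumes "degree q \<le> n"
  shows "poly_mv M q v = (\<Sum>i\<le>n. coeff q i *s ((*v) M ^^ i) v)"
  unfolding poly_mv_def
  by (rule sum.mono_neutral_left) (use assms in \<open>auto simp: coeff_eq_0\<close>)

lemma poly_mv_0 [simp]: "poly_mv M 0 v = 0"
  by (simp add: poly_mv_def)

lemma poly_mv_pCons: "poly_mv M (pCons a q) v = a *s v + M *v poly_mv M q v"
proof -
  have "poly_mv M (pCons a q) v = (\<Sum>i\<le>Suc (degree q). coeff (pCons a q) i *s ((*v) M ^^ i) v)"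
    by (rule poly_mv_eq_sum) (simp add: degree_pCons_le)
  also have "\<dots> = a *s v + (\<Sum>i\<le>degree q. coeff q i *s ((*v) M ^^ Suc i) v)"
    by (subst sum.atMost_Suc_shift) simp
  also have "(\<Sum>i\<le>degree q. coeff q i *s ((*v) M ^^ Suc i) v) = M *v poly_mv M q v"
    by (simp add: poly_mv_def vec.linear_sum[OF matrix_vector_mul_linear_gen] vector_scalar_commute)
  finally show ?thesis .
qed

lemma poly_mv_add: "poly_mv M (p + q) v = poly_mv M p v + poly_mv M q v"
  by (induction p q rule: poly_induct2) (simp_all add: poly_mv_pCons algebra_simps)

lemma poly_mv_smult: "poly_mv M (smult c p) v = c *s poly_mv M p v"
  by (induction p) (simp_all add: poly_mv_pCons vector_scalar_commute algebra_simps)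

lemma poly_mv_mult: "poly_mv M (p * q) v = poly_mv M p (poly_mv M q v)"
  by (induction p) (simp_all add: poly_mv_pCons poly_mv_add poly_mv_smult)

lemma poly_mv_linear: "poly_mv M [:-r, 1:] v = M *v v - r *s v"
  by (simp add: poly_mv_pCons algebra_simps)

text \<open>The N+1 vectors M^i v, i \<le> N, are linearly dependent over \<real>, N being the real
  dimension of complex^'n.\<close>

lemma poly_mv_annihilator_exists:
  fixes M :: "complex^'n::finite^'n"
  shows "\<exists>q. q \<noteq> 0 \<and> poly_mv M q v = 0"
proof -
  define N where "N = DIM(complex^'n)"
  define f where "f i = ((*v) M ^^ i) v" for i
  show ?thesis
  proof (cases "inj_on f {..N}")
    case False
    then obtain i j where ij: "i \<le> N" "j \<le> N" "i \<noteq> j" "f i = f j"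
      unfolding inj_on_def by auto
    define q where "q = monom (1::complex) i - monom 1 j"
    have "coeff q i = 1" using ij by (simp add: q_def)
    then have "q \<noteq> 0" by auto
    have "poly_mv M q v = (\<Sum>l\<le>N. coeff q l *s f l)"
      unfolding f_def by (rule poly_mv_eq_sum)
        (use ij in \<open>auto simp: q_def degree_monom_eq intro!: degree_diff_le\<close>)
    also have "\<dots> = (\<Sum>l\<le>N. (if l = i then f l else 0) - (if l = j then f l else 0))"
      by (rule sum.cong) (auto simp: q_def)
    also have "\<dots> = f i - f j"
      using ij by (simp add: sum_subtractf)
    finally show ?thesis using \<open>q \<noteq> 0\<close> ij(4) by auto
  next
    case True
    have "card (f ` {..N}) = Suc N" using True by (simp add: card_image)
    then have "dependent (f ` {..N})"
      by (intro dependent_biggerset) (simp add: N_def del: DIM_cart)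
    then obtain c where c: "\<exists>x\<in>f ` {..N}. c x \<noteq> 0" "(\<Sum>x\<in>f ` {..N}. c x *\<^sub>R x) = 0"
      using dependent_finite[of "f ` {..N}"] by auto
    define q where "q = (\<Sum>i\<le>N. monom (complex_of_real (c (f i))) i)"
    have coeff_q: "coeff q i = (if i \<le> N then complex_of_real (c (f i)) else 0)" for i
      by (simp add: q_def coeff_sum)
    have "degree q \<le> N"
      by (rule ccontr) (use coeff_q[of "degree q"] in \<open>auto simp: q_def\<close>)
    from c(1) obtain i where "i \<le> N" "c (f i) \<noteq> 0" by auto
    then have "q \<noteq> 0" using coeff_q[of i] by auto
    have "poly_mv M q v = (\<Sum>i\<le>N. c (f i) *\<^sub>R f i)"
      using poly_mv_eq_sum[OF \<open>degree q \<le> N\<close>]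
      by (simp add: coeff_q f_def scaleR_eq_of_real_scale)
    also have "\<dots> = 0"
      using c(2) sum.reindex[OF True, of "\<lambda>x. c x *\<^sub>R x"] by simp
    finally show ?thesis using \<open>q \<noteq> 0\<close> by blast
  qed
qed

text \<open>Factor a root r off an annihilator g of least degree, g = (x - r) h; then h(M)v \<noteq> 0
  and (M - r) h(M)v = 0.\<close>

lemma krylov_eigenvector_exists:
  fixes M :: "complex^'n::finite^'n"
  assumes "v \<noteq> 0"
  shows "\<exists>h r. poly_mv M h v \<noteq> 0 \<and> M *v poly_mv M h v = r *s poly_mv M h v"
proof -
  obtain g where g: "g \<noteq> 0" "poly_mv M g v = 0"
    and least: "\<And>q. q \<noteq> 0 \<and> poly_mv M q v = 0 \<Longrightarrow> degree g \<le> degree q"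
    using ex_has_least_nat[of "\<lambda>q. q \<noteq> 0 \<and> poly_mv M q v = 0" _ degree]
      poly_mv_annihilator_exists by metis
  have "degree g \<noteq> 0"
  proof
    assume "degree g = 0"
    then have "g = [:coeff g 0:]" "coeff g 0 \<noteq> 0" using g(1) by (auto elim: degree_eq_zeroE)
    then show False using g(2) assms by (metis poly_mv_pCons poly_mv_0 add.right_neutral
        matrix_vector_mult_0_right vector_mul_eq_0)
  qed
  then obtain r where "poly g r = 0"
    using fundamental_theorem_of_algebra[of g] by (auto simp: constant_degree)
  then obtain h where h: "g = [:-r, 1:] * h" by (auto simp: poly_eq_0_iff_dvd)
  have "h \<noteq> 0" using h g(1) by auto
  moreover have "degree g = Suc (degree h)"
    using h degree_mult_eq[of "[:-r, 1:]" h] \<open>h \<noteq> 0\<close> by (simp del: mult_pCons_left)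
  ultimately have "poly_mv M h v \<noteq> 0" using least[of h] by auto
  moreover have "M *v poly_mv M h v - r *s poly_mv M h v = 0"
    using g(2) unfolding h poly_mv_mult poly_mv_linear .
  ultimately show ?thesis by auto
qed

section \<open>Hermitian matrices\<close>

definition hermitian :: "complex^'n::finite^'n \<Rightarrow> bool" where
  "hermitian M \<longleftrightarrow> (\<forall>i j. M$i$j = cnj (M$j$i))"

lemma hermitian_add: "hermitian X \<Longrightarrow> hermitian Y \<Longrightarrow> hermitian (X + Y)"
  unfolding hermitian_def by (metis complex_cnj_add vector_add_component)

lemma hermitian_diff: "hermitian X \<Longrightarrow> hermitian Y \<Longrightarrow> hermitian (X - Y)"
  unfolding hermitian_def by (metis complex_cnj_diff vector_minus_component)

lemma hermitian_cinner:
  assumes "hermitian M"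
  shows "cinner x (M *v y) = cinner (M *v x) y"
proof -
  have entry: "cnj (M$j$i) = M$i$j" for i j
    using assms unfolding hermitian_def by metis
  have "cinner x (M *v y) = (\<Sum>i\<in>UNIV. \<Sum>j\<in>UNIV. cnj (x$i) * M$i$j * y$j)"
    by (simp add: cinner_def matrix_vector_mult_def sum_distrib_left mult.assoc)
  also have "\<dots> = (\<Sum>j\<in>UNIV. \<Sum>i\<in>UNIV. cnj (x$i) * M$i$j * y$j)"
    by (rule sum.swap)
  also have "\<dots> = cinner (M *v x) y"
    by (simp add: cinner_def matrix_vector_mult_def sum_distrib_left sum_distrib_right entry mult_ac)
  finally show ?thesis .
qed

lemma hermitian_eigenvalue_real:
  assumes "hermitian M" "M *v x = l *s x" "x \<noteq> 0"
  shows "cnj l = l"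
proof -
  have "l * cinner x x = cnj l * cinner x x"
    using hermitian_cinner[OF assms(1), of x x] assms(2)
    by (simp add: cinner_scale_right cinner_scale_left)
  with assms(3) show ?thesis by simp
qed

lemma hermitian_eigenvectors_orthogonal:
  assumes "hermitian M" "M *v x = l *s x" "M *v y = m *s y" "cnj l = l" "l \<noteq> m"
  shows "cinner x y = 0"
proof -
  have "m * cinner x y = l * cinner x y"
    using hermitian_cinner[OF assms(1), of x y] assms(2-4)
    by (simp add: cinner_scale_right cinner_scale_left)
  with assms(5) show ?thesis by simp
qed

lemma hermitian_finite_spectrum:
  assumes "hermitian M"
  shows "finite (mat_spec M)"
proof -
  define ev where "ev l = (SOME v. v \<noteq> 0 \<and> M *v v = l *s v)" for l
  have ev: "ev l \<noteq> 0 \<and> M *v ev l = l *s ev l" if "l \<in> mat_spec M" for l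
    using that someI_ex[of "\<lambda>v. v \<noteq> 0 \<and> M *v v = l *s v"] by (auto simp: mat_spec_def ev_def)
  have "inj_on ev (mat_spec M)"
  proof (rule inj_onI)
    fix l m assume "l \<in> mat_spec M" "m \<in> mat_spec M" "ev l = ev m"
    then have "(l - m) *s ev l = 0" using ev by (metis vector_sub_rdistrib right_minus_eq)
    then show "l = m" using ev \<open>l \<in> mat_spec M\<close> by simp
  qed
  moreover have "pairwise orthogonal (ev ` mat_spec M)"
  proof (rule pairwiseI)
    fix x y assume "x \<in> ev ` mat_spec M" "y \<in> ev ` mat_spec M" "x \<noteq> y"
    then obtain l m where lm: "l \<in> mat_spec M" "m \<in> mat_spec M" "x = ev l" "y = ev m" "l \<noteq> m"
      by auto
    have "cinner x y = 0"
      using hermitian_eigenvectors_orthogonal[OF assms] hermitian_eigenvalue_real[OF assms] ev lm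
      by metis
    then show "orthogonal x y" using Re_cinner[of x y] by (simp add: orthogonal_def)
  qed
  then have "independent (ev ` mat_spec M)"
    using ev by (intro pairwise_orthogonal_independent) auto
  then have "finite (ev ` mat_spec M)" using independent_bound by blast
  ultimately show ?thesis using finite_imageD by blast
qed

lemma cinner_eigenvector_poly_mv:
  assumes "hermitian M" "M *v w = r *s w" "cnj r = r"
  shows "cinner w (poly_mv M q y) = poly q r * cinner w y"
proof (induction q)
  case (pCons a q)
  have "cinner w (M *v poly_mv M q y) = r * cinner w (poly_mv M q y)"
    using hermitian_cinner[OF assms(1)] assms(2,3) by (simp add: cinner_scale_left)
  then show ?case using pCons.IH
    by (simp add: poly_mv_pCons cinner_add_right cinner_scale_right algebra_simps)
qed (simp add: cinner_def)

section \<open>Eigenspace projections and the eigenvalue support\<close>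

lemma eig_space_add: "x \<in> eig_space M r \<Longrightarrow> y \<in> eig_space M r \<Longrightarrow> x + y \<in> eig_space M r"
  by (simp add: eig_space_def matrix_vector_right_distrib)

lemma eig_space_scale: "x \<in> eig_space M r \<Longrightarrow> c *s x \<in> eig_space M r"
  by (simp add: eig_space_def vector_scalar_commute mult.commute)

lemma subspace_eig_space: "subspace (eig_space M r)"
  by (auto simp: subspace_def scaleR_eq_of_real_scale intro: eig_space_add eig_space_scale)
    (simp add: eig_space_def)

lemma eig_proj_unique:
  assumes "w \<in> eig_space M r" "\<forall>v \<in> eig_space M r. cinner v (u - w) = 0"
  shows "eig_proj M r u = w"
  unfolding eig_proj_def
proof (rule the_equality)
  fix w' assume w': "w' \<in> eig_space M r \<and> (\<forall>v\<in>eig_space M r. cinner v (u - w') = 0)"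
  have "w' - w \<in> eig_space M r"
    using w' assms(1) subspace_eig_space by (blast intro: subspace_diff)
  then have "cinner (w' - w) ((u - w) - (u - w')) = 0"
    using assms(2) w' by (simp add: cinner_diff_right)
  then show "w' = w" by simp
qed (use assms in blast)

text \<open>The complex orthogonal complement is obtained from the real one, since an eigenspace is
  closed under multiplication by \<i>.\<close>

lemma eig_proj_exists: "\<exists>w \<in> eig_space M r. \<forall>v \<in> eig_space M r. cinner v (u - w) = 0"
proof -
  have span: "span (eig_space M r) = eig_space M r"
    using subspace_eig_space by simp
  obtain w z where w: "w \<in> eig_space M r" and u: "u = w + z"
    and z: "\<And>v. v \<in> eig_space M r \<Longrightarrow> orthogonal z v"
    using orthogonal_subspace_decomp_exists[of "eig_space M r" u] span by metis
  have "cinner v z = 0" if "v \<in> eig_space M r" for v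
    using z[OF that] z[OF eig_space_scale[OF that, of \<i>]]
    by (simp add: complex_eq_iff Re_cinner Im_cinner orthogonal_def inner_commute)
  then show ?thesis using w u by (metis add_diff_cancel_left')
qed

lemma eig_proj_eq_0_iff: "eig_proj M r u = 0 \<longleftrightarrow> (\<forall>v \<in> eig_space M r. cinner v u = 0)"
proof
  assume "eig_proj M r u = 0"
  obtain w where "w \<in> eig_space M r" "\<forall>v \<in> eig_space M r. cinner v (u - w) = 0"
    using eig_proj_exists by blast
  moreover from this have "w = 0" using \<open>eig_proj M r u = 0\<close> eig_proj_unique by metis
  ultimately show "\<forall>v \<in> eig_space M r. cinner v u = 0" by simp
next
  assume "\<forall>v \<in> eig_space M r. cinner v u = 0"
  then show "eig_proj M r u = 0"
    by (intro eig_proj_unique) (auto simp: eig_space_def)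
qed

lemma eig_support_eigenvector:
  assumes "hermitian M" "u \<noteq> 0" "M *v u = m *s u"
  shows "eig_support M u = {m}"
proof -
  have "m \<in> mat_spec M" using assms(2,3) by (auto simp: mat_spec_def)
  moreover have "u \<in> eig_space M m" using assms(3) by (simp add: eig_space_def)
  moreover have "cinner u u \<noteq> 0" using assms(2) by simp
  ultimately have "m \<in> eig_support M u"
    unfolding eig_support_def eig_proj_eq_0_iff by blast
  moreover have "l = m" if "l \<in> eig_support M u" for l
  proof (rule ccontr)
    assume "l \<noteq> m"
    have "cnj l = l" using that assms(1) hermitian_eigenvalue_real
      by (auto simp: eig_support_def mat_spec_def)
    then have "\<forall>v \<in> eig_space M l. cinner v u = 0"
      using hermitian_eigenvectors_orthogonal[OF assms(1) _ assms(3)] \<open>l \<noteq> m\<close>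
      by (auto simp: eig_space_def)
    then show False using that by (simp add: eig_support_def eig_proj_eq_0_iff)
  qed
  ultimately show ?thesis by blast
qed

lemma eig_support_annihilates:
  assumes "hermitian M"
  shows "poly_mv M (\<Prod>l\<in>eig_support M u. [:-l, 1:]) u = 0"
proof (rule ccontr)
  define p where "p = (\<Prod>l\<in>eig_support M u. [:-l, 1:])"
  assume "poly_mv M (\<Prod>l\<in>eig_support M u. [:-l, 1:]) u \<noteq> 0"
  then have "poly_mv M p u \<noteq> 0" by (simp add: p_def)
  then obtain h r where "poly_mv M h (poly_mv M p u) \<noteq> 0"
    "M *v poly_mv M h (poly_mv M p u) = r *s poly_mv M h (poly_mv M p u)"
    using krylov_eigenvector_exists by blast
  then obtain w where w: "w \<noteq> 0" "M *v w = r *s w" "w = poly_mv M (h * p) u"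
    by (simp add: poly_mv_mult)
  have real: "cnj r = r" using hermitian_eigenvalue_real[OF assms w(2,1)] .
  have "poly p r = 0 \<or> cinner w u = 0"
  proof (cases "r \<in> eig_support M u")
    case True
    have "finite (eig_support M u)"
      using hermitian_finite_spectrum[OF assms] by (simp add: eig_support_def)
    with True show ?thesis by (simp add: p_def poly_prod)
  next
    case False
    moreover have "r \<in> mat_spec M" "w \<in> eig_space M r"
      using w by (auto simp: mat_spec_def eig_space_def)
    ultimately show ?thesis by (auto simp: eig_support_def eig_proj_eq_0_iff)
  qed
  then have "cinner w w = 0"
    using cinner_eigenvector_poly_mv[OF assms w(2) real, of "h * p" u] w(3) by auto
  with w(1) show False by simp
qed

section \<open>Powers of a graph matrix applied to a vertex\<close>

lemma relpow_sym: "sym R \<Longrightarrow> (x, y) \<in> R ^^ n \<Longrightarrow> (y, x) \<in> R ^^ n"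
proof (induction n arbitrary: x y)
  case (Suc n)
  then obtain z where "(x, z) \<in> R ^^ n" "(z, y) \<in> R" by (meson relpow_Suc_E)
  with Suc show ?case by (meson relpow_Suc_I2 symD)
qed simp

text \<open>M = D + \<sigma>A for some diagonal matrix D, where A is the adjacency matrix of E.\<close>

definition adjacency_offdiag :: "('n \<Rightarrow> 'n \<Rightarrow> bool) \<Rightarrow> complex \<Rightarrow> complex^'n^'n::finite \<Rightarrow> bool" where
  "adjacency_offdiag E \<sigma> M \<longleftrightarrow> (\<forall>x y. x \<noteq> y \<longrightarrow> M$x$y = (if E x y then \<sigma> else 0))"

text \<open>Only shortest walks contribute to the entry of M^j e_a at a vertex y with
  dist(a, y) \<ge> j, each with weight \<sigma>^j; the diagonal never contributes.\<close>

lemma mpow_axis_shortest_walks: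
  assumes sym: "\<forall>x y. E x y \<longrightarrow> E y x" and M: "adjacency_offdiag E \<sigma> M"
    and "\<forall>i<j. (a, y) \<notin> edge_rel E ^^ i"
  shows "\<exists>c\<ge>0. ((*v) M ^^ j) (axis a 1) $ y = \<sigma>^j * of_real c
           \<and> (c > 0 \<longleftrightarrow> (a, y) \<in> edge_rel E ^^ j)"
  using assms(3)
proof (induction j arbitrary: y)
  case 0
  show ?case by (intro exI[of _ "if y = a then 1 else 0"]) (auto simp: axis_def)
next
  case (Suc j)
  define v where "v = ((*v) M ^^ j) (axis a 1)"
  have "\<exists>c\<ge>0. M$y$x * v$x = \<sigma>^Suc j * of_real c
          \<and> (c > 0 \<longleftrightarrow> E x y \<and> (a, x) \<in> edge_rel E ^^ j)" for x
  proof (cases "x \<noteq> y \<and> E x y")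
    case True
    then have "\<forall>i<j. (a, x) \<notin> edge_rel E ^^ i"
      using Suc.prems by (auto simp: edge_rel_def intro: relpow_Suc_I)
    then obtain c where "c \<ge> 0" "v$x = \<sigma>^j * of_real c" "c > 0 \<longleftrightarrow> (a, x) \<in> edge_rel E ^^ j"
      using Suc.IH v_def by blast
    moreover have "M$y$x = \<sigma>" using True sym M by (auto simp: adjacency_offdiag_def)
    ultimately show ?thesis using True by (intro exI[of _ c]) auto
  next
    case False
    have "M$y$x * v$x = 0"
    proof (cases "x = y")
      case True
      then obtain c where "v$x = \<sigma>^j * of_real c" "c > 0 \<longleftrightarrow> (a, x) \<in> edge_rel E ^^ j" "c \<ge> 0"
        using Suc.IH[of y] Suc.prems v_def by auto
      then show ?thesis using True Suc.prems by auto
    qed (use False sym M in \<open>auto simp: adjacency_offdiag_def\<close>)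
    with False Suc.prems show ?thesis by (intro exI[of _ 0]) auto
  qed
  then obtain c where c: "\<And>x. c x \<ge> 0" "\<And>x. M$y$x * v$x = \<sigma>^Suc j * of_real (c x)"
    "\<And>x. c x > 0 \<longleftrightarrow> E x y \<and> (a, x) \<in> edge_rel E ^^ j"
    by metis
  have "((*v) M ^^ Suc j) (axis a 1) $ y = \<sigma>^Suc j * of_real (\<Sum>x\<in>UNIV. c x)"
    by (simp add: matrix_vector_mult_def v_def[symmetric] c(2) sum_distrib_left)
  moreover have "(\<Sum>x\<in>UNIV. c x) > 0 \<longleftrightarrow> (\<exists>x. c x > 0)"
    using c(1) by (simp add: less_le sum_nonneg sum_nonneg_eq_0_iff)
  then have "(\<Sum>x\<in>UNIV. c x) > 0 \<longleftrightarrow> (a, y) \<in> edge_rel E ^^ Suc j"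
    by (auto simp: c(3) edge_rel_def)
  ultimately show ?case using c(1) by (intro exI[of _ "\<Sum>x\<in>UNIV. c x"]) (auto intro: sum_nonneg)
qed

lemma mpow_axis_beyond_reach:
  assumes "\<forall>x y. E x y \<longrightarrow> E y x" "adjacency_offdiag E \<sigma> M"
    and "\<forall>i\<le>j. (a, y) \<notin> edge_rel E ^^ i"
  shows "((*v) M ^^ j) (axis a 1) $ y = 0"
  using mpow_axis_shortest_walks[OF assms(1,2), of j a y] assms(3) by auto

text \<open>Evaluate p(M)(e_a + s e_b) at the vertex w at distance k from a on a shortest
  a-b path: for i \<le> k the vector M^i e_b vanishes at w, and so does M^i e_a for i < k.\<close>

lemma graph_dist_le_twice_degree:
  assumes sym: "\<forall>x y. E x y \<longrightarrow> E y x" and M: "adjacency_offdiag E \<sigma> M" and "\<sigma> \<noteq> 0"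
    and "(a, b) \<in> (edge_rel E)\<^sup>*" and "lead_coeff p = 1"
    and ann: "poly_mv M p (axis a 1 + s *s axis b 1) = 0"
  shows "graph_dist E a b \<le> 2 * degree p"
proof (rule ccontr)
  define k d where "k = degree p" and "d = graph_dist E a b"
  define R where "R = edge_rel E"
  assume "\<not> graph_dist E a b \<le> 2 * degree p"
  then have "2 * k < d" by (simp add: k_def d_def)
  have "(a, b) \<in> R ^^ d"
    using assms(4) unfolding d_def graph_dist_def R_def by (meson LeastI rtrancl_power)
  have shortest: "d \<le> m" if "(a, b) \<in> R ^^ m" for m
    using that unfolding d_def graph_dist_def R_def by (rule Least_le)
  obtain w where w: "(a, w) \<in> R ^^ k" "(w, b) \<in> R ^^ (d - k)"
    using \<open>(a, b) \<in> R ^^ d\<close> \<open>2 * k < d\<close> relpow_add[of k "d - k" R] by auto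
  have far_a: "(a, w) \<notin> R ^^ i" if "i < k" for i
  proof
    assume "(a, w) \<in> R ^^ i"
    then have "(a, b) \<in> R ^^ i O R ^^ (d - k)" using w(2) by blast
    then have "d \<le> i + (d - k)" using shortest relpow_add by metis
    with that \<open>2 * k < d\<close> show False by linarith
  qed
  have far_b: "(b, w) \<notin> R ^^ i" if "i \<le> k" for i
  proof
    assume "(b, w) \<in> R ^^ i"
    then have "(w, b) \<in> R ^^ i" using sym by (auto simp: R_def edge_rel_def sym_def intro: relpow_sym)
    then have "(a, b) \<in> R ^^ k O R ^^ i" using w(1) by blast
    then have "d \<le> k + i" using shortest relpow_add by metis
    with that \<open>2 * k < d\<close> show False by linarith
  qed
  obtain c where c: "c > 0" "((*v) M ^^ k) (axis a 1) $ w = \<sigma>^k * of_real c"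
    using mpow_axis_shortest_walks[OF sym M, of k a w] w(1) far_a by (auto simp: R_def)
  have summand: "coeff p i * (((*v) M ^^ i) (axis a 1) $ w + s * ((*v) M ^^ i) (axis b 1) $ w)
        = (if i = k then \<sigma>^k * of_real c else 0)" if "i \<le> k" for i
  proof -
    have "((*v) M ^^ i) (axis b 1) $ w = 0"
      using mpow_axis_beyond_reach[OF sym M] far_b that by (auto simp: R_def)
    moreover have "((*v) M ^^ i) (axis a 1) $ w = 0" if "i < k"
      using mpow_axis_beyond_reach[OF sym M] far_a \<open>i < k\<close> by (auto simp: R_def)
    ultimately show ?thesis using c(2) \<open>lead_coeff p = 1\<close> that by (auto simp: k_def)
  qed
  have "0 = poly_mv M p (axis a 1 + s *s axis b 1) $ w" using ann by simp
  also have "\<dots> =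
      (\<Sum>i\<le>k. coeff p i * (((*v) M ^^ i) (axis a 1) $ w + s * ((*v) M ^^ i) (axis b 1) $ w))"
    by (simp add: poly_mv_def k_def mpow_vec_add mpow_vec_scale distrib_left mult.assoc)
  also have "\<dots> = (\<Sum>i\<le>k. if i = k then \<sigma>^k * of_real c else 0)"
    by (rule sum.cong) (simp_all add: summand)
  also have "\<dots> = \<sigma>^k * of_real c"
    by simp
  finally show False using \<open>\<sigma> \<noteq> 0\<close> \<open>c > 0\<close> by simp
qed

section \<open>Adjacency matrix, Laplacian and signless Laplacian\<close>

lemma hermitian_adj_matrix: "\<forall>x y. E x y \<longrightarrow> E y x \<Longrightarrow> hermitian (adj_matrix E)"
  unfolding hermitian_def adj_matrix_def by auto

lemma hermitian_deg_matrix: "hermitian (deg_matrix E)"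
  unfolding hermitian_def deg_matrix_def by auto

lemma graph_matrix_cases:
  assumes "simple_graph E" "M \<in> {adj_matrix E, laplacian E, signless_laplacian E}"
  shows "hermitian M" "\<exists>\<sigma>. \<sigma> \<noteq> 0 \<and> adjacency_offdiag E \<sigma> M"
proof -
  have "hermitian (adj_matrix E)"
    using assms(1) by (intro hermitian_adj_matrix) (simp add: simple_graph_def)
  with assms(2) show "hermitian M"
    by (auto simp: laplacian_def signless_laplacian_def
        intro: hermitian_add hermitian_diff hermitian_deg_matrix)
  have "adjacency_offdiag E 1 (adj_matrix E)" "adjacency_offdiag E (-1) (laplacian E)"
    "adjacency_offdiag E 1 (signless_laplacian E)"
    by (simp_all add: adjacency_offdiag_def laplacian_def signless_laplacian_def
        adj_matrix_def deg_matrix_def)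
  with assms(2) show "\<exists>\<sigma>. \<sigma> \<noteq> 0 \<and> adjacency_offdiag E \<sigma> M"
    by (metis insert_iff neg_equal_0_iff_equal singletonD zero_neq_one)
qed

theorem mainTheorem1:
  fixes E :: "'n::finite \<Rightarrow> 'n \<Rightarrow> bool" and M :: "complex^'n^'n"
    and a b :: 'n and s :: complex
  assumes "simple_graph E" and "connected_graph E"
    and "M \<in> {adj_matrix E, laplacian E, signless_laplacian E}"
    and "a \<noteq> b" and "s \<noteq> 0"
  shows "(is_eigenvector M (axis a 1 + s *s axis b 1) \<longrightarrow>
            card (eig_support M (axis a 1 + s *s axis b 1)) = 1)
       \<and> (\<not> is_eigenvector M (axis a 1 + s *s axis b 1) \<longrightarrow>
            real (card (eig_support M (axis a 1 + s *s axis b 1)))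
              \<ge> of_int \<lceil>real (graph_dist E a b) / 2\<rceil>)"
proof -
  define u where "u = axis a 1 + s *s axis b (1::complex)"
  define p where "p = (\<Prod>l\<in>eig_support M u. [:-l, 1:])"
  have sym: "\<forall>x y. E x y \<longrightarrow> E y x" using assms(1) by (simp add: simple_graph_def)
  have herm: "hermitian M" using graph_matrix_cases[OF assms(1,3)] by blast
  obtain \<sigma> where "\<sigma> \<noteq> 0" "adjacency_offdiag E \<sigma> M"
    using graph_matrix_cases[OF assms(1,3)] by blast
  have "u $ a = 1" using \<open>a \<noteq> b\<close> by (simp add: u_def axis_def)
  then have eigenvector: "is_eigenvector M u \<longrightarrow> card (eig_support M u) = 1"
    using eig_support_eigenvector[OF herm] by (auto simp: is_eigenvector_def)
  have "(a, b) \<in> (edge_rel E)\<^sup>*" using assms(2) by (simp add: connected_graph_def)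
  moreover have "lead_coeff p = 1"
    unfolding p_def lead_coeff_prod by simp
  ultimately have "graph_dist E a b \<le> 2 * degree p"
    using graph_dist_le_twice_degree[OF sym \<open>adjacency_offdiag E \<sigma> M\<close> \<open>\<sigma> \<noteq> 0\<close>]
      eig_support_annihilates[OF herm, of u]
    by (simp add: p_def u_def)
  also have "degree p = card (eig_support M u)"
    by (simp add: p_def degree_prod_sum_eq)
  finally have "real (graph_dist E a b) / 2 \<le> real (card (eig_support M u))"
    by linarith
  then have "\<lceil>real (graph_dist E a b) / 2\<rceil> \<le> int (card (eig_support M u))"
    by (simp add: ceiling_le_iff)
  with eigenvector show ?thesis by (simp add: u_def)
qed

end
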